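(* Let $n\ge1$, $k\ge1$, and let $b\neq 0$ be an integer. There is a constant $C$, independent of the domain, such that for every convex domain $\Delta\subseteq\mathbb{R}^n$ (compact, of full dimension) of diameter $\omega\ge1$, \[\left||\Delta_b^k| - \left(\prod_{p^k\mid b}\left(1-\frac{1}{p^{kn}}\right)\right)\mathrm{vol}(\Delta)\right| \le C\,\omega^{n-1},\] i.e. the left-hand side is $O(\omega^{n-1})$, where the product is over all distinct primes $p$ with $p^k\mid b$.
   Context: For $\Delta\subseteq\mathbb{R}^n$, $\Delta_1=\Delta\cap\mathbb{Z}^n$, and $\Delta_b^k$ is the set of $\vec x=(x_1,\dots,x_n)\in\Delta_1$ that are relatively $k$-free to $b$, i.e. such that $p^k\nmid\gcd(x_1,\dots,x_n,b)$ for every prime $p$. The diameter is the supremum of distances between points of $\Delta$; $\mathrm{vol}$ is $n$-dimensional Lebesgue measure. *)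

theory Defs
  imports "HOL-Analysis.Analysis" "HOL-Computational_Algebra.Primes"
begin

definition lattice_points :: "(real ^ 'n) set \<Rightarrow> (real ^ 'n) set" where
  "lattice_points \<Delta> = \<Delta> \<inter> {x. \<forall>i. x $ i \<in> \<int>}"

(* Intended for points with integer coordinates: the floor only moves these from real to int. *)
definition relatively_k_free :: "nat \<Rightarrow> int \<Rightarrow> real ^ 'n \<Rightarrow> bool" where
  "relatively_k_free k b x \<longleftrightarrow>
     (\<forall>p::nat. prime p \<longrightarrow> \<not> int p ^ k dvd gcd (Gcd (range (\<lambda>i. \<lfloor>x $ i\<rfloor>))) b)"

definition k_free_points :: "nat \<Rightarrow> int \<Rightarrow> (real ^ 'n) set \<Rightarrow> (real ^ 'n) set" where
  "k_free_points k b \<Delta> = {x \<in> lattice_points \<Delta>. relatively_k_free k b x}"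

end

theory Submission
  imports Defs
begin

text \<open>
  The number of integer points of a convex body is its volume with respect to the product of the
  counting measures of \<open>\<int>\<close>. Replacing one factor after another by Lebesgue measure changes the
  volume only slightly: a line parallel to an axis meets the body in a segment, on which the two
  measures differ by at most 1, and the remaining coordinates range over a box of volume
  \<open>O(\<omega> ^ (n - 1))\<close>. Scaling gives the same estimate for the points of \<open>m \<int>\<^sup>n\<close>, and sieving by one
  prime power after another produces the product over the primes.
\<close>

section \<open>Exchanging the factors of a product measure\<close>

text \<open>Fubini with coordinate \<open>j\<close> innermost reduces the claim to the slices of
  \<open>A\<close> parallel to axis \<open>j\<close>. The 1 lost on a slice counts only where the
  slice is nonempty, hence only over the box spanned by the other sides \<open>B i\<close>, and the
  measure of that box is the product on the right.\<close>

lemma emeasure_PiM_change_component: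
  fixes M N :: "'i \<Rightarrow> real measure"
  assumes sf: "\<And>i. sigma_finite_measure (M i)" "\<And>i. sigma_finite_measure (N i)"
    and sets [measurable_cong]: "\<And>i. sets (M i) = sets borel" "\<And>i. sets (N i) = sets borel"
    and I: "finite I" "j \<in> I"
    and agree: "\<And>i. i \<in> I - {j} \<Longrightarrow> M i = N i"
    and A: "A \<in> sets (PiM I (\<lambda>_. borel))" "A \<subseteq> PiE I B"
    and B: "\<And>i. i \<in> I \<Longrightarrow> B i \<in> sets borel"
    and slice: "\<And>x. emeasure (M j) {y. x(j := y) \<in> A} \<le> emeasure (N j) {y. x(j := y) \<in> A} + 1"
  shows "emeasure (PiM I M) A \<le> emeasure (PiM I N) A + (\<Prod>i\<in>I - {j}. emeasure (N i) (B i))"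
proof -
  interpret M: product_sigma_finite M
    using sf by (simp add: product_sigma_finite_def)
  interpret N: product_sigma_finite N
    using sf by (simp add: product_sigma_finite_def)
  let ?I = "I - {j}"
  have I': "finite ?I" "j \<notin> ?I" "insert j ?I = I" using I by auto
  have space: "space (M i) = UNIV" "space (N i) = UNIV" for i
    using sets_eq_imp_space_eq[OF sets(1)] sets_eq_imp_space_eq[OF sets(2)] by auto
  have AM: "A \<in> sets (PiM I M)" and AN: "A \<in> sets (PiM I N)"
    using A(1) sets_PiM_cong[OF refl, of I M "\<lambda>_. borel"] sets_PiM_cong[OF refl, of I N "\<lambda>_. borel"] sets
    by auto
  have slice_sets: "{y. x(j := y) \<in> A} \<in> sets borel" if "x \<in> space (PiM ?I N)" for x
  proof -
    have "(\<lambda>y. x(j := y)) \<in> measurable borel (PiM I (\<lambda>_. borel))"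
      using that I by (intro measurable_PiM_single') (auto simp: space_PiM PiE_iff extensional_def)
    from measurable_sets[OF this A(1)] show ?thesis by (simp add: vimage_def)
  qed
  have integ: "(\<integral>\<^sup>+ y. indicator A (x(j := y)) \<partial>K) = emeasure K {y. x(j := y) \<in> A}"
    if "x \<in> space (PiM ?I N)" "sets K = sets borel" for x K
  proof -
    have "(\<lambda>y. indicator A (x(j := y)) :: ennreal) = indicator {y. x(j := y) \<in> A}"
      by (auto simp: indicator_def)
    then show ?thesis using slice_sets[OF that(1)] that(2) by simp
  qed
  have eq: "PiM ?I M = PiM ?I N" by (intro PiM_cong agree) auto
  have box: "PiE ?I B \<in> sets (PiM ?I N)"
    using B I sets by (intro sets_PiM_I_finite) auto
  have "emeasure (PiM I M) A = (\<integral>\<^sup>+ x. (\<integral>\<^sup>+ y. indicator A (x(j := y)) \<partial>M j) \<partial>PiM ?I M)"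
    using M.product_nn_integral_insert[OF I'(1,2), of "indicator A"] AM I'(3) by simp
  also have "\<dots> = (\<integral>\<^sup>+ x. emeasure (M j) {y. x(j := y) \<in> A} \<partial>PiM ?I N)"
    unfolding eq by (intro nn_integral_cong integ sets)
  \<comment> \<open>Charging the error as the indicator of the box, rather than as the constant 1,
    keeps its integral finite when the sides have finite measure.\<close>
  also have "\<dots> \<le> (\<integral>\<^sup>+ x. (\<integral>\<^sup>+ y. indicator A (x(j := y)) \<partial>N j) + indicator (PiE ?I B) x \<partial>PiM ?I N)"
  proof (intro nn_integral_mono)
    fix x assume x: "x \<in> space (PiM ?I N)"
    show "emeasure (M j) {y. x(j := y) \<in> A}
      \<le> (\<integral>\<^sup>+ y. indicator A (x(j := y)) \<partial>N j) + indicator (PiE ?I B) x"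
    proof (cases "x \<in> PiE ?I B")
      case True
      then show ?thesis using slice[of x] integ[OF x sets(2)] by simp
    next
      case False
      \<comment> \<open>A point of \<open>A\<close> above \<open>x\<close> would put every remaining
        coordinate of \<open>x\<close> into its side, against the case assumption.\<close>
      have "{y. x(j := y) \<in> A} = {}"
      proof (rule ccontr)
        assume "{y. x(j := y) \<in> A} \<noteq> {}"
        then obtain y where "x(j := y) \<in> PiE I B" using A(2) by blast
        then have "x i \<in> B i" if "i \<in> ?I" for i
          using that by (auto simp: PiE_iff dest!: bspec[of I _ i])
        then show False using False x by (auto simp: space_PiM PiE_iff)
      qed
      then show ?thesis by simp
    qed
  qed
  also have "\<dots> = (\<integral>\<^sup>+ x. (\<integral>\<^sup>+ y. indicator A (x(j := y)) \<partial>N j) \<partial>PiM ?I N) + emeasure (PiM ?I N) (PiE ?I B)"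
  proof (subst nn_integral_add)
    have [measurable]: "(\<lambda>(f, y). f(j := y)) \<in> measurable (PiM ?I N \<Otimes>\<^sub>M N j) (PiM I N)"
      using measurable_add_dim[of j ?I N] I'(3) by simp
    note AN[measurable]
    interpret Nj: sigma_finite_measure "N j" by (rule sf)
    show "(\<lambda>x. \<integral>\<^sup>+ y. indicator A (x(j := y)) \<partial>N j) \<in> borel_measurable (PiM ?I N)"
      by measurable
  qed (use box in auto)
  also have "(\<integral>\<^sup>+ x. (\<integral>\<^sup>+ y. indicator A (x(j := y)) \<partial>N j) \<partial>PiM ?I N) = emeasure (PiM I N) A"
    using N.product_nn_integral_insert[OF I'(1,2), of "indicator A"] AN I'(3) by simp
  also have "emeasure (PiM ?I N) (PiE ?I B) = (\<Prod>i\<in>?I. emeasure (N i) (B i))"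
    using B sets I' by (intro N.emeasure_PiM) auto
  finally show ?thesis .
qed

text \<open>A hybrid argument: the coordinates are switched from \<nu> to \<mu> one at a time, and
  each switch costs at most a product of \<open>card I - 1\<close> side measures. The intermediate
  products mix both measures, so \<open>K\<close> has to bound the sides under each of them.\<close>

lemma emeasure_PiM_change_measure:
  fixes \<mu> \<nu> :: "real measure" and K :: ennreal
  assumes sf: "sigma_finite_measure \<mu>" "sigma_finite_measure \<nu>"
    and sets: "sets \<mu> = sets borel" "sets \<nu> = sets borel"
    and I: "finite I"
    and A: "A \<in> sets (PiM I (\<lambda>_. borel))" "A \<subseteq> PiE I B"
    and B: "\<And>i. i \<in> I \<Longrightarrow> B i \<in> sets borel"
    and K: "\<And>i. i \<in> I \<Longrightarrow> emeasure \<mu> (B i) \<le> K" "\<And>i. i \<in> I \<Longrightarrow> emeasure \<nu> (B i) \<le> K"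
    and slice: "\<And>x j. j \<in> I \<Longrightarrow> emeasure \<mu> {y. x(j := y) \<in> A} \<le> emeasure \<nu> {y. x(j := y) \<in> A} + 1"
  shows "emeasure (PiM I (\<lambda>_. \<mu>)) A \<le> emeasure (PiM I (\<lambda>_. \<nu>)) A + of_nat (card I) * K ^ (card I - 1)"
proof -
  \<comment> \<open>The hybrid family has \<mu> on \<open>J\<close> and \<nu> elsewhere, so
    \<open>h {}\<close> is constantly \<nu> and \<open>h I\<close> agrees with \<mu> on
    \<open>I\<close>.\<close>
  define h where "h J = (\<lambda>i. if i \<in> J then \<mu> else \<nu>)" for J :: "'a set"
  have "emeasure (PiM I (h J)) A \<le> emeasure (PiM I (\<lambda>_. \<nu>)) A + of_nat (card J) * K ^ (card I - 1)"
    if "J \<subseteq> I" for J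
    using finite_subset[OF that I] that
  proof (induction J rule: finite_induct)
    case empty
    then show ?case by (simp add: h_def)
  next
    case (insert j J)
    have "emeasure (PiM I (h (insert j J))) A
      \<le> emeasure (PiM I (h J)) A + (\<Prod>i\<in>I - {j}. emeasure (h J i) (B i))"
      using insert sf sets I A B slice
      by (intro emeasure_PiM_change_component) (auto simp: h_def)
    also have "(\<Prod>i\<in>I - {j}. emeasure (h J i) (B i)) \<le> (\<Prod>i\<in>I - {j}. K)"
      using K by (intro prod_mono_ennreal) (auto simp: h_def)
    also have "\<dots> = K ^ (card I - 1)" using insert I by simp
    finally show ?case using insert
      by (simp add: distrib_right add.assoc add.commute add_mono order_trans)
  qed
  from this[of I] show ?thesis
    using PiM_cong[of I I "h I" "\<lambda>_. \<mu>"] by (simp add: h_def cong: PiM_cong)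
qed

section \<open>Lebesgue measure on vectors as a product measure\<close>

lemma measurable_vec_lambda_PiM [measurable]:
  "vec_lambda \<in> measurable (PiM UNIV (\<lambda>_::'n::finite. borel)) (borel :: (real ^ 'n) measure)"
proof (subst borel_measurable_euclidean_space, intro ballI)
  fix b :: "real ^ 'n" assume "b \<in> Basis"
  then obtain i where "b = axis i 1" by (auto simp: Basis_vec_def)
  then show "(\<lambda>f. vec_lambda f \<bullet> b) \<in> borel_measurable (PiM UNIV (\<lambda>_. borel))"
    by (simp add: inner_axis)
qed

text \<open>Lebesgue measure is determined by its values on boxes, and the preimage of a box under
  \<open>vec_lambda\<close> is a product of open intervals. This carries volumes over to
  \<open>PiM\<close>, where single factors can be exchanged.\<close>

lemma lborel_eq_distr_PiM_vec:
  "lborel = distr (PiM UNIV (\<lambda>_::'n::finite. lborel)) (borel :: (real ^ 'n) measure) vec_lambda"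
proof (rule lborel_eqI)
  fix l u :: "real ^ 'n"
  assume lu: "\<And>b. b \<in> Basis \<Longrightarrow> l \<bullet> b \<le> u \<bullet> b"
  have le: "l $ i \<le> u $ i" for i
    using lu[of "axis i 1"] by (auto simp: inner_axis Basis_vec_def)
  interpret product_sigma_finite "\<lambda>_::'n. lborel :: real measure" ..
  have "vec_lambda -` box l u = PiE UNIV (\<lambda>i. {l $ i<..<u $ i})"
    by (auto simp: mem_box_cart PiE_iff)
  moreover have "vec_lambda \<in> measurable (PiM UNIV (\<lambda>_::'n. lborel)) (borel :: (real ^ 'n) measure)"
    by measurable
  ultimately have "emeasure (distr (PiM UNIV (\<lambda>_::'n. lborel)) borel vec_lambda) (box l u)
      = (\<Prod>i\<in>UNIV. emeasure lborel {l $ i<..<u $ i})"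
    by (simp add: emeasure_distr space_PiM emeasure_PiM)
  also have "\<dots> = ennreal (\<Prod>i\<in>UNIV. u $ i - l $ i)"
    using le by (simp add: prod_ennreal)
  also have "(\<Prod>i\<in>UNIV. u $ i - l $ i) = (\<Prod>b\<in>Basis. (u - l) \<bullet> b)"
  proof -
    have "bij_betw (\<lambda>i. axis i (1::real)) (UNIV :: 'n set) Basis"
      by (auto simp: bij_betw_def inj_on_def Basis_vec_def axis_eq_axis)
    from prod.reindex_bij_betw[OF this, of "\<lambda>b. (u - l) \<bullet> b"] show ?thesis
      by (simp add: inner_axis)
  qed
  finally show "emeasure (distr (PiM UNIV (\<lambda>_::'n. lborel)) borel vec_lambda) (box l u)
      = ennreal (\<Prod>b\<in>Basis. (u - l) \<bullet> b)" .
qed simp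

section \<open>The counting measure of the integers on the real line\<close>

text \<open>Pushing the counting measure forward to the Borel sets of the reals gives it the same
  measurable sets as \<open>lborel\<close>, as the exchange of factors requires.\<close>

definition integer_count :: "real measure" where
  "integer_count = distr (count_space (UNIV :: int set)) borel of_int"

lemma sets_integer_count [simp, measurable_cong]: "sets integer_count = sets borel"
  by (simp add: integer_count_def)

lemma emeasure_integer_count:
  "A \<in> sets borel \<Longrightarrow> emeasure integer_count A = emeasure (count_space UNIV) {z :: int. of_int z \<in> A}"
  by (simp add: integer_count_def emeasure_distr vimage_def)

text \<open>The integers in the interval run from \<open>\<lceil>a\<rceil>\<close> to
  \<open>\<lfloor>b\<rfloor>\<close>. For \<open>a > b\<close> the argument of \<open>nat\<close>
  may be negative, and its truncation to 0 is the measure of the empty interval.\<close>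

lemma emeasure_integer_count_atLeastAtMost:
  "emeasure integer_count {a..b} = of_nat (nat (\<lfloor>b\<rfloor> - \<lceil>a\<rceil> + 1))"
proof -
  have "{z :: int. of_int z \<in> {a..b}} = {\<lceil>a\<rceil>..\<lfloor>b\<rfloor>}"
    by (auto simp: le_floor_iff ceiling_le_iff)
  then show ?thesis by (simp add: emeasure_integer_count algebra_simps)
qed

lemma sigma_finite_integer_count: "sigma_finite_measure integer_count"
proof
  let ?A = "range (\<lambda>n::nat. {- real n..real n})"
  have "x \<in> \<Union>?A" for x
  proof -
    obtain n where "\<bar>x\<bar> \<le> real n" using real_arch_simple by blast
    then have "x \<in> {- real n..real n}" by auto
    then show ?thesis by blast
  qed
  then have "\<Union>?A = space integer_count" by (auto simp: integer_count_def)
  then show "\<exists>A. countable A \<and> A \<subseteq> sets integer_count \<and> \<Union>A = space integer_count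
      \<and> (\<forall>a\<in>A. emeasure integer_count a \<noteq> \<infinity>)"
    by (intro exI[of _ ?A] conjI) (auto simp: emeasure_integer_count_atLeastAtMost)
qed

text \<open>Rounding inwards by \<open>\<lfloor>b\<rfloor> \<le> b\<close> and
  \<open>a \<le> \<lceil>a\<rceil>\<close> leaves only the 1 from counting both endpoints.\<close>

lemma integer_count_le_lborel:
  assumes "a \<le> b"
  shows "emeasure integer_count {a..b} \<le> emeasure lborel {a..b} + 1"
proof -
  have "real (nat (\<lfloor>b\<rfloor> - \<lceil>a\<rceil> + 1)) \<le> (b - a) + 1"
    using assms by linarith
  then show ?thesis using assms
    by (simp add: emeasure_integer_count_atLeastAtMost ennreal_of_nat_eq_real_of_nat ennreal_plus[symmetric]
        ennreal_1[symmetric] ennreal_leI del: ennreal_plus ennreal_1)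
qed

text \<open>Each endpoint moves by less than 1 under rounding; counting both endpoints recovers one
  of these two units.\<close>

lemma lborel_le_integer_count:
  assumes "a \<le> b"
  shows "emeasure lborel {a..b} \<le> emeasure integer_count {a..b} + 1"
proof -
  have "b - a \<le> real (nat (\<lfloor>b\<rfloor> - \<lceil>a\<rceil> + 1)) + 1"
    using assms by linarith
  then show ?thesis using assms
    by (simp add: emeasure_integer_count_atLeastAtMost ennreal_of_nat_eq_real_of_nat ennreal_plus[symmetric]
        ennreal_1[symmetric] ennreal_leI del: ennreal_plus ennreal_1)
qed

text \<open>The product measure is concentrated on the integer points and gives each of them mass 1.
  Finiteness allows the measure to be summed over singletons.\<close>

lemma emeasure_PiM_integer_count:
  fixes A :: "('n::finite \<Rightarrow> real) set"
  assumes A: "A \<in> sets (PiM UNIV (\<lambda>_. borel))" and fin: "finite (A \<inter> {f. \<forall>i. f i \<in> \<int>})"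
  shows "emeasure (PiM UNIV (\<lambda>_. integer_count)) A = of_nat (card (A \<inter> {f. \<forall>i. f i \<in> \<int>}))"
proof -
  let ?N = "PiM UNIV (\<lambda>_::'n. integer_count)" and ?Z = "{f :: 'n \<Rightarrow> real. \<forall>i. f i \<in> \<int>}"
  interpret product_sigma_finite "\<lambda>_::'n. integer_count"
    using sigma_finite_integer_count by (simp add: product_sigma_finite_def)
  have space: "space ?N = UNIV" by (simp add: space_PiM integer_count_def)
  have sets: "sets ?N = sets (PiM UNIV (\<lambda>_::'n. borel))" by (intro sets_PiM_cong) auto
  have rect: "emeasure ?N {f. \<forall>i. f i \<in> B i} = (\<Prod>i\<in>UNIV. emeasure integer_count (B i))"
    and rect_sets: "{f. \<forall>i. f i \<in> B i} \<in> sets ?N"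
    if "\<And>i. B i \<in> sets borel" for B :: "'n \<Rightarrow> real set"
  proof -
    have "{f. \<forall>i. f i \<in> B i} = PiE UNIV B" by (auto simp: PiE_iff)
    then show "emeasure ?N {f. \<forall>i. f i \<in> B i} = (\<Prod>i\<in>UNIV. emeasure integer_count (B i))"
      "{f. \<forall>i. f i \<in> B i} \<in> sets ?N"
      using that emeasure_PiM[of UNIV B] by (auto intro!: sets_PiM_I_finite)
  qed
  have Z: "?Z \<in> sets ?N" using rect_sets[of "\<lambda>_. \<int>"] by simp
  have single: "{f} \<in> sets ?N" for f :: "'n \<Rightarrow> real"
  proof -
    have "{f} = {g. \<forall>i. g i \<in> {f i}}" by auto
    then show ?thesis using rect_sets[of "\<lambda>i. {f i}"] by simp
  qed
  have ae: "AE f in ?N. f i \<in> \<int>" for i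
  proof (rule AE_I)
    \<comment> \<open>The cylinder of points whose coordinate \<open>i\<close> is not an integer has
      one factor of measure 0. The other factors are infinite, but in \<open>ennreal\<close> the
      product is still 0.\<close>
    let ?B = "\<lambda>j. if j = i then - \<int> else (UNIV :: real set)"
    have B: "?B j \<in> sets borel" for j by auto
    have "emeasure integer_count (?B i) = 0" by (simp add: emeasure_integer_count)
    then show "emeasure ?N {f. \<forall>j. f j \<in> ?B j} = 0"
      unfolding rect[OF B] by (intro prod_zero) auto
    show "{f. \<forall>j. f j \<in> ?B j} \<in> sets ?N" by (rule rect_sets[OF B])
    show "{f \<in> space ?N. f i \<notin> \<int>} \<subseteq> {f. \<forall>j. f j \<in> ?B j}" by auto
  qed
  have "AE f in ?N. f \<in> ?Z" using ae by (simp add: AE_all_countable)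
  then have "emeasure ?N A = emeasure ?N (A \<inter> ?Z)"
    using A Z sets by (intro emeasure_eq_AE) auto
  also have "\<dots> = (\<Sum>f\<in>A \<inter> ?Z. emeasure ?N {f})"
    using fin single by (intro emeasure_eq_sum_singleton)
  also have "\<dots> = (\<Sum>f\<in>A \<inter> ?Z. 1)"
  proof (intro sum.cong refl)
    fix f assume f: "f \<in> A \<inter> ?Z"
    have "emeasure integer_count {f i} = 1" for i
    proof -
      from f obtain z where "f i = of_int z" by (auto elim: Ints_cases)
      then show ?thesis using emeasure_integer_count_atLeastAtMost[of "f i" "f i"] by simp
    qed
    moreover have "{f} = {g. \<forall>i. g i \<in> {f i}}" by auto
    ultimately show "emeasure ?N {f} = 1" using rect[of "\<lambda>i. {f i}"] by simp
  qed
  finally show ?thesis by simp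
qed

section \<open>Lattice points of a convex body\<close>

lemma finite_lattice_points:
  fixes \<Delta> :: "(real ^ 'n) set"
  assumes "bounded \<Delta>"
  shows "finite (lattice_points \<Delta>)"
proof -
  obtain L where L: "\<And>x. x \<in> \<Delta> \<Longrightarrow> norm x \<le> L"
    using assms by (auto simp: bounded_iff)
  let ?B = "PiE (UNIV :: 'n set) (\<lambda>_. {z \<in> \<int>. - L \<le> z \<and> z \<le> L})"
  have "x \<in> vec_lambda ` ?B" if "x \<in> lattice_points \<Delta>" for x
  proof (rule image_eqI)
    have "\<bar>x $ i\<bar> \<le> L" for i
      using that L[of x] component_le_norm_cart[of x i] by (auto simp: lattice_points_def)
    then have "- L \<le> x $ i \<and> x $ i \<le> L" for i by (simp add: abs_le_iff minus_le_iff)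
    then show "vec_nth x \<in> ?B" using that by (auto simp: lattice_points_def PiE_iff)
  qed simp
  moreover have "finite ?B" by (intro finite_PiE finite_int_segment) auto
  ultimately show ?thesis by (meson finite_imageI finite_subset subsetI)
qed

text \<open>The number of lattice points and the volume are two product measures of the same set.
  Convexity makes every slice parallel to an axis a segment, on which the factors differ by at most
  1, so the exchange applies in both directions. Allowing any centre \<open>c\<close> makes the
  bound independent of the position of \<Delta>.\<close>

lemma card_lattice_points_approx:
  fixes \<Delta> :: "(real ^ 'n) set" and L :: real
  assumes \<Delta>: "compact \<Delta>" "convex \<Delta>" and L: "0 \<le> L"
    and box: "\<And>x i. x \<in> \<Delta> \<Longrightarrow> \<bar>x $ i - c $ i\<bar> \<le> L"
  shows "\<bar>real (card (lattice_points \<Delta>)) - measure lebesgue \<Delta>\<bar>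
      \<le> CARD('n) * (2 * L + 1) ^ (CARD('n) - 1)"
proof -
  let ?A = "(vec_lambda :: ('n \<Rightarrow> real) \<Rightarrow> real ^ 'n) -` \<Delta>" and ?Z = "{f :: 'n \<Rightarrow> real. \<forall>i. f i \<in> \<int>}"
  define B where "B i = {c $ i - L..c $ i + L}" for i
  \<comment> \<open>A segment of length \<open>2 * L\<close> contains at most
    \<open>2 * L + 1\<close> integers, so \<open>K\<close> bounds its length and its count
    alike.\<close>
  define K where "K = ennreal (2 * L + 1)"
  have \<Delta>_borel: "\<Delta> \<in> sets borel" using \<Delta> by (simp add: borel_compact)
  have A_box: "?A \<subseteq> PiE UNIV B"
  proof
    fix f :: "'n \<Rightarrow> real" assume "f \<in> ?A"
    then have "\<bar>f i - c $ i\<bar> \<le> L" for i using box[of "vec_lambda f" i] by simp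
    then show "f \<in> PiE UNIV B" by (simp add: B_def PiE_iff abs_le_iff algebra_simps)
  qed
  have A_sets: "?A \<in> sets (PiM UNIV (\<lambda>_. borel))"
    using measurable_sets[OF measurable_vec_lambda_PiM \<Delta>_borel] by (simp add: space_PiM)
  have bij: "bij_betw vec_lambda (?A \<inter> ?Z) (lattice_points \<Delta>)"
    by (rule bij_betwI[of _ _ _ vec_nth]) (auto simp: lattice_points_def)
  then have fin: "finite (?A \<inter> ?Z)"
    using finite_lattice_points[OF compact_imp_bounded[OF \<Delta>(1)]] bij_betw_finite by blast
  \<comment> \<open>A slice is closed, bounded and convex, hence a compact interval. The empty slice
    is kept apart because the one-dimensional comparisons assume \<open>a \<le> b\<close>.\<close>
  have slice: "{y. x(j := y) \<in> ?A} = {} \<or> (\<exists>a b. a \<le> b \<and> {y. x(j := y) \<in> ?A} = {a..b})" for x j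
  proof -
    let ?S = "{y. x(j := y) \<in> ?A}" and ?g = "\<lambda>y. vec_lambda (x(j := y))"
    have S: "?S = ?g -` \<Delta>" by (simp add: vimage_def)
    have "continuous_on UNIV ?g"
    proof (rule continuous_on_vec_lambda)
      show "continuous_on UNIV (\<lambda>y. (x(j := y)) i)" for i by (cases "i = j") auto
    qed
    then have "closed ?S" unfolding S
      using \<Delta> by (intro closed_vimage compact_imp_closed)
    moreover have "?S \<subseteq> B j"
    proof
      fix y assume "y \<in> ?S"
      then have "x(j := y) \<in> PiE UNIV B" using A_box by blast
      then show "y \<in> B j" by (auto simp: PiE_iff dest: spec[of _ j])
    qed
    then have "bounded ?S" unfolding B_def using bounded_closed_interval bounded_subset by blast
    moreover have "convex ?S"
    proof (rule convexI)
      fix y z u v :: real assume *: "y \<in> ?S" "z \<in> ?S" "0 \<le> u" "0 \<le> v" "u + v = 1"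
      then have "u *\<^sub>R ?g y + v *\<^sub>R ?g z \<in> \<Delta>" using convexD[OF \<Delta>(2)] by auto
      \<comment> \<open>Coordinates other than \<open>j\<close> agree at both points and are
        preserved because the weights sum to 1.\<close>
      also have "u *\<^sub>R ?g y + v *\<^sub>R ?g z = ?g (u *\<^sub>R y + v *\<^sub>R z)"
        using *(5) by (simp add: vec_eq_iff flip: distrib_right)
      finally show "u *\<^sub>R y + v *\<^sub>R z \<in> ?S" by auto
    qed
    ultimately obtain a b where "?S = {a..b}"
      using connected_compact_interval_1[of ?S] compact_eq_bounded_closed convex_connected by blast
    then show ?thesis by (cases "a \<le> b") auto
  qed
  have le: "emeasure integer_count {y. x(j := y) \<in> ?A} \<le> emeasure lborel {y. x(j := y) \<in> ?A} + 1"
    "emeasure lborel {y. x(j := y) \<in> ?A} \<le> emeasure integer_count {y. x(j := y) \<in> ?A} + 1" for x j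
    using slice[of x j] integer_count_le_lborel lborel_le_integer_count by auto
  have K: "emeasure lborel (B i) \<le> K" "emeasure integer_count (B i) \<le> K" for i
  proof -
    have "emeasure lborel (B i) = ennreal (2 * L)" using L by (simp add: B_def)
    moreover have "ennreal (2 * L) + 1 = K" using L by (simp add: K_def flip: ennreal_plus ennreal_1)
    ultimately show "emeasure lborel (B i) \<le> K" "emeasure integer_count (B i) \<le> K"
      using integer_count_le_lborel[of "c $ i - L" "c $ i + L"] L
      by (auto simp: B_def K_def intro!: ennreal_leI)
  qed
  have B: "B i \<in> sets borel" for i by (simp add: B_def)
  let ?E = "CARD('n) * (2 * L + 1) ^ (CARD('n) - 1)"
  have E: "of_nat CARD('n) * K ^ (CARD('n) - 1) = ennreal ?E"
    using L by (simp add: K_def ennreal_of_nat_eq_real_of_nat ennreal_power ennreal_mult del: ennreal_plus)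
  have count: "emeasure (PiM UNIV (\<lambda>_. integer_count)) ?A = ennreal (card (lattice_points \<Delta>))"
    unfolding emeasure_PiM_integer_count[OF A_sets fin] bij_betw_same_card[OF bij]
    by (rule ennreal_of_nat_eq_real_of_nat)
  have vol: "emeasure (PiM UNIV (\<lambda>_. lborel)) ?A = ennreal (measure lebesgue \<Delta>)"
  proof -
    have "vec_lambda \<in> measurable (PiM UNIV (\<lambda>_::'n. lborel)) (borel :: (real ^ 'n) measure)"
      by measurable
    from emeasure_distr[OF this \<Delta>_borel]
    have "emeasure (PiM UNIV (\<lambda>_. lborel)) ?A = emeasure lborel \<Delta>"
      unfolding lborel_eq_distr_PiM_vec[symmetric] by (simp add: space_PiM)
    also have "\<dots> = emeasure lebesgue \<Delta>" using \<Delta>_borel by simp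
    also have "\<dots> = ennreal (measure lebesgue \<Delta>)"
      using \<Delta>(1) by (intro emeasure_eq_measure2 lmeasurable_compact)
    finally show ?thesis .
  qed
  note change = emeasure_PiM_change_measure[OF _ _ _ _ finite A_sets A_box B]
  have "ennreal (card (lattice_points \<Delta>)) \<le> ennreal (measure lebesgue \<Delta>) + ennreal ?E"
    unfolding count[symmetric] vol[symmetric] E[symmetric]
    by (rule change) (simp_all only: le K sigma_finite_integer_count
        lborel.sigma_finite_measure_axioms sets_integer_count sets_lborel)
  moreover have "ennreal (measure lebesgue \<Delta>) \<le> ennreal (card (lattice_points \<Delta>)) + ennreal ?E"
    unfolding count[symmetric] vol[symmetric] E[symmetric]
    by (rule change) (simp_all only: le K sigma_finite_integer_count
        lborel.sigma_finite_measure_axioms sets_integer_count sets_lborel)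
  moreover have "0 \<le> ?E" using L by simp
  ultimately show "\<bar>real (card (lattice_points \<Delta>)) - measure lebesgue \<Delta>\<bar> \<le> ?E"
    by (simp flip: ennreal_plus add: abs_le_iff)
qed

section \<open>The sieve\<close>

text \<open>A state of the sieve: \<open>m\<close> collects divisibility conditions imposed on all
  coordinates, \<open>P\<close> the primes whose \<open>k\<close>-th powers must not divide them
  all. Carrying \<open>m\<close> along makes the family closed under the recursion that adds one
  prime to \<open>P\<close>.\<close>

definition sifted :: "nat \<Rightarrow> nat set \<Rightarrow> nat \<Rightarrow> (real ^ 'n) set \<Rightarrow> (real ^ 'n) set" where
  "sifted k P m \<Delta> = {x \<in> lattice_points \<Delta>.
     (\<forall>i. int m dvd \<lfloor>x $ i\<rfloor>) \<and> (\<forall>p\<in>P. \<not> (\<forall>i. int p ^ k dvd \<lfloor>x $ i\<rfloor>))}"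

text \<open>With no prime to exclude, what remains is the part of \<Delta> in the lattice of
  multiples of \<open>m\<close>; shrinking by \<open>m\<close> turns this lattice into the standard
  one.\<close>

lemma sifted_empty_eq_image:
  assumes "m > 0"
  shows "sifted k {} m \<Delta> = (*\<^sub>R) (real m) ` lattice_points ((*\<^sub>R) (1 / real m) ` \<Delta>)"
proof (intro equalityI subsetI)
  fix x assume x: "x \<in> sifted k {} m \<Delta>"
  let ?y = "(1 / real m) *\<^sub>R x"
  have "?y $ i \<in> \<int>" for i
  proof -
    have "x $ i \<in> \<int>" "int m dvd \<lfloor>x $ i\<rfloor>" using x by (auto simp: sifted_def lattice_points_def)
    then obtain z where "x $ i = of_int (int m * z)"
      by (metis Ints_cases dvdE floor_of_int)
    then have "?y $ i = of_int z" using assms by simp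
    then show ?thesis by simp
  qed
  then have "?y \<in> lattice_points ((*\<^sub>R) (1 / real m) ` \<Delta>)"
    using x by (auto simp: lattice_points_def sifted_def)
  moreover have "x = real m *\<^sub>R ?y" using assms by simp
  ultimately show "x \<in> (*\<^sub>R) (real m) ` lattice_points ((*\<^sub>R) (1 / real m) ` \<Delta>)" by blast
next
  fix x assume "x \<in> (*\<^sub>R) (real m) ` lattice_points ((*\<^sub>R) (1 / real m) ` \<Delta>)"
  then obtain y where y: "x = real m *\<^sub>R ((1 / real m) *\<^sub>R y)" "y \<in> \<Delta>" "\<And>i. ((1 / real m) *\<^sub>R y) $ i \<in> \<int>"
    unfolding lattice_points_def by blast
  have "x $ i \<in> \<int> \<and> int m dvd \<lfloor>x $ i\<rfloor>" for i
  proof -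
    obtain z where "((1 / real m) *\<^sub>R y) $ i = of_int z" using y(3) Ints_cases by metis
    then have "x $ i = of_int (int m * z)" using y(1) assms by (simp add: field_simps)
    then show ?thesis by (metis Ints_of_int dvd_triv_left floor_of_int)
  qed
  moreover have "x \<in> \<Delta>" using y assms by simp
  ultimately show "x \<in> sifted k {} m \<Delta>" by (simp add: sifted_def lattice_points_def)
qed

text \<open>The lattice point estimate is applied to \<Delta> shrunk by \<open>m\<close>, whose
  volume is divided by the \<open>n\<close>-th power of \<open>m\<close>. The shrunk body still fits
  into a cube of half side \<open>diameter \<Delta>\<close>, so the error bound does not depend on
  \<open>m\<close>.\<close>

lemma card_sifted_empty_approx:
  fixes \<Delta> :: "(real ^ 'n) set"
  assumes m: "m > 0" and \<Delta>: "compact \<Delta>" "convex \<Delta>" "diameter \<Delta> \<ge> 1"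
  shows "\<bar>real (card (sifted k {} m \<Delta>)) - measure lebesgue \<Delta> / real m ^ CARD('n)\<bar>
    \<le> CARD('n) * 3 ^ (CARD('n) - 1) * diameter \<Delta> ^ (CARD('n) - 1)"
proof -
  let ?d = "diameter \<Delta>" and ?n = "CARD('n)" and ?S = "(*\<^sub>R) (1 / real m) ` \<Delta>"
  \<comment> \<open>The empty set has diameter 0, so \<Delta> has a point, whose image serves as the
    centre of the cube.\<close>
  obtain x0 where x0: "x0 \<in> \<Delta>" using \<Delta>(3) by force
  have S: "compact ?S" "convex ?S" using \<Delta> by (auto intro: compact_scaling convex_scaling)
  have box: "\<bar>y $ i - ((1 / real m) *\<^sub>R x0) $ i\<bar> \<le> ?d" if "y \<in> ?S" for y i
  proof -
    from that obtain x where x: "x \<in> \<Delta>" "y = (1 / real m) *\<^sub>R x" by auto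
    have "\<bar>y $ i - ((1 / real m) *\<^sub>R x0) $ i\<bar> = \<bar>(x - x0) $ i\<bar> / m"
      using m by (simp add: x(2) flip: diff_divide_distrib)
    also have "\<dots> \<le> \<bar>(x - x0) $ i\<bar> / 1" using m by (intro divide_left_mono) auto
    also have "\<dots> = \<bar>(x - x0) $ i\<bar>" by simp
    also have "\<dots> \<le> dist x x0" unfolding dist_norm by (rule component_le_norm_cart)
    also have "\<dots> \<le> ?d"
      using diameter_bounded_bound[OF compact_imp_bounded[OF \<Delta>(1)] x(1) x0] .
    finally show ?thesis .
  qed
  have vol: "measure lebesgue ?S = measure lebesgue \<Delta> / real m ^ ?n"
    using measure_lebesgue_affine[of "1 / real m" "0 :: real ^ 'n" \<Delta>] by (simp add: power_one_over)
  have card: "card (sifted k {} m \<Delta>) = card (lattice_points ?S)"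
    using m by (simp add: sifted_empty_eq_image card_image inj_on_def)
  have "\<bar>real (card (lattice_points ?S)) - measure lebesgue ?S\<bar> \<le> ?n * (2 * ?d + 1) ^ (?n - 1)"
    using \<Delta>(3) by (intro card_lattice_points_approx[OF S _ box]) auto
  \<comment> \<open>Since \<open>?d \<ge> 1\<close>, the summand 1 is absorbed into a third copy of
    \<open>?d\<close>; this is the source of the 3 in the constant.\<close>
  also have "\<dots> \<le> ?n * (3 * ?d) ^ (?n - 1)"
    using \<Delta>(3) by (intro mult_left_mono power_mono) auto
  finally have "\<bar>real (card (sifted k {} m \<Delta>)) - measure lebesgue \<Delta> / real m ^ ?n\<bar>
      \<le> ?n * (3 * ?d) ^ (?n - 1)" unfolding vol card .
  then show ?thesis by (simp add: power_mult_distrib mult.assoc)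
qed

text \<open>One step of inclusion-exclusion: the points lost by excluding \<open>p\<close> are those
  with all coordinates divisible by both \<open>m\<close> and \<open>p ^ k\<close>, which by
  coprimality means by \<open>m * p ^ k\<close>.\<close>

lemma card_sifted_insert:
  fixes \<Delta> :: "(real ^ 'n) set"
  assumes fin: "finite (lattice_points \<Delta>)" and cop: "coprime m p"
  shows "real (card (sifted k (insert p P) m \<Delta>))
    = real (card (sifted k P m \<Delta>)) - real (card (sifted k P (m * p ^ k) \<Delta>))"
proof -
  have dvd: "int (m * p ^ k) dvd z \<longleftrightarrow> int m dvd z \<and> int p ^ k dvd z" for z
    using cop by (auto intro: divides_mult dest: dvd_mult_left dvd_mult_right)
  have sub: "sifted k P (m * p ^ k) \<Delta> \<subseteq> sifted k P m \<Delta>"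
    unfolding sifted_def dvd by auto
  have fin': "finite (sifted k P m \<Delta>)"
    using fin by (rule rev_finite_subset) (auto simp: sifted_def)
  have "sifted k (insert p P) m \<Delta> = sifted k P m \<Delta> - sifted k P (m * p ^ k) \<Delta>"
    unfolding sifted_def dvd by auto
  then show ?thesis
    using card_Diff_subset[OF finite_subset[OF sub fin'] sub] card_mono[OF fin' sub] by simp
qed

text \<open>Induction on \<open>P\<close> with \<open>m\<close> arbitrary, because adding
  \<open>p\<close> calls on the hypothesis both for \<open>m\<close> and for
  \<open>m * p ^ k\<close>. The main terms combine to one more factor of the product, and the error
  constants add up.\<close>

lemma card_sifted_approx:
  assumes "finite P" "\<And>p. p \<in> P \<Longrightarrow> prime p" "m > 0" "\<And>p. p \<in> P \<Longrightarrow> coprime m p"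
  shows "\<exists>C::real. \<forall>\<Delta> :: (real ^ 'n) set. compact \<Delta> \<longrightarrow> convex \<Delta> \<longrightarrow> diameter \<Delta> \<ge> 1 \<longrightarrow>
    \<bar>real (card (sifted k P m \<Delta>))
      - (\<Prod>p\<in>P. 1 - 1 / real p ^ (k * CARD('n))) / real m ^ CARD('n) * measure lebesgue \<Delta>\<bar>
    \<le> C * diameter \<Delta> ^ (CARD('n) - 1)"
  using assms
proof (induction P arbitrary: m rule: finite_induct)
  case empty
  then show ?case
    using card_sifted_empty_approx[of m _ k] by (auto intro!: exI[of _ "CARD('n) * 3 ^ (CARD('n) - 1)"])
next
  case (insert p P)
  let ?n = "CARD('n)"
  let ?Q = "\<Prod>p\<in>P. 1 - 1 / real p ^ (k * ?n)"
  have p: "prime p" "p > 0" using insert.prems(1) prime_gt_0_nat by auto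
  \<comment> \<open>Distinct primes are coprime, so the new modulus still satisfies the coprimality
    hypothesis for the primes in \<open>P\<close>.\<close>
  have cop: "coprime (m * p ^ k) q" if "q \<in> P" for q
  proof -
    have "coprime p q" using that insert primes_coprime[of p q] by auto
    then show ?thesis using that insert.prems(3) by (auto intro: coprime_power_left_iff[THEN iffD2])
  qed
  \<comment> \<open>Both constants are fixed before any \<Delta> is chosen, which makes their sum
    uniform over all bodies.\<close>
  obtain C1 where C1: "\<And>\<Delta> :: (real ^ 'n) set. compact \<Delta> \<Longrightarrow> convex \<Delta> \<Longrightarrow> diameter \<Delta> \<ge> 1 \<Longrightarrow>
    \<bar>real (card (sifted k P m \<Delta>)) - ?Q / real m ^ ?n * measure lebesgue \<Delta>\<bar> \<le> C1 * diameter \<Delta> ^ (?n - 1)"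
    using insert.IH[of m] insert.prems by auto
  obtain C2 where C2: "\<And>\<Delta> :: (real ^ 'n) set. compact \<Delta> \<Longrightarrow> convex \<Delta> \<Longrightarrow> diameter \<Delta> \<ge> 1 \<Longrightarrow>
    \<bar>real (card (sifted k P (m * p ^ k) \<Delta>)) - ?Q / real (m * p ^ k) ^ ?n * measure lebesgue \<Delta>\<bar>
      \<le> C2 * diameter \<Delta> ^ (?n - 1)"
    using insert.IH[of "m * p ^ k"] insert.prems p cop by auto
  show ?case
  proof (intro exI[of _ "C1 + C2"] allI impI)
    fix \<Delta> :: "(real ^ 'n) set"
    assume \<Delta>: "compact \<Delta>" "convex \<Delta>" "diameter \<Delta> \<ge> 1"
    \<comment> \<open>The difference of the two main coefficients splits off exactly the factor
      belonging to \<open>p\<close>.\<close>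
    have "(\<Prod>q\<in>insert p P. 1 - 1 / real q ^ (k * ?n)) / real m ^ ?n
      = ?Q / real m ^ ?n - ?Q / real (m * p ^ k) ^ ?n"
      using insert.hyps p insert.prems(2)
      by (simp add: field_simps power_mult_distrib flip: power_mult)
    then show "\<bar>real (card (sifted k (insert p P) m \<Delta>))
        - (\<Prod>q\<in>insert p P. 1 - 1 / real q ^ (k * ?n)) / real m ^ ?n * measure lebesgue \<Delta>\<bar>
      \<le> (C1 + C2) * diameter \<Delta> ^ (?n - 1)"
      using C1[OF \<Delta>] C2[OF \<Delta>] insert.prems(3)[of p]
        card_sifted_insert[OF finite_lattice_points[OF compact_imp_bounded[OF \<Delta>(1)]], of m p k P]
      by (simp add: left_diff_distrib distrib_right del: prod.insert)
  qed
qed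

section \<open>From relatively k-free points to the sieve\<close>

text \<open>A prime power divides the gcd exactly when it divides \<open>b\<close> and every
  coordinate, so only primes with \<open>int p ^ k dvd b\<close> can exclude a point. The modulus 1
  imposes no condition.\<close>

lemma k_free_points_eq_sifted:
  "k_free_points k b \<Delta> = sifted k {p. prime p \<and> int p ^ k dvd b} 1 \<Delta>"
  by (auto simp: k_free_points_def sifted_def relatively_k_free_def dvd_Gcd_iff)

text \<open>As \<open>k \<ge> 1\<close>, such a prime divides \<open>b\<close> itself, and a divisor
  of a nonzero integer is at most its absolute value.\<close>

lemma finite_prime_power_divisors:
  fixes b :: int
  assumes "k \<ge> 1" "b \<noteq> 0"
  shows "finite {p::nat. prime p \<and> int p ^ k dvd b}"
proof (rule finite_subset)
  show "{p::nat. prime p \<and> int p ^ k dvd b} \<subseteq> {..nat \<bar>b\<bar>}"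
  proof
    fix p :: nat assume "p \<in> {p. prime p \<and> int p ^ k dvd b}"
    then have "int p dvd b"
      using assms(1) dvd_trans[OF dvd_power[of k "int p"]] by auto
    then show "p \<in> {..nat \<bar>b\<bar>}" using dvd_imp_le_int[OF assms(2)] by fastforce
  qed
qed simp

theorem theorem4p1:
  fixes k :: nat and b :: int
  assumes "k \<ge> 1" and "b \<noteq> 0"
  shows "\<exists>C::real. \<forall>\<Delta> :: (real ^ 'n) set.
    compact \<Delta> \<longrightarrow> convex \<Delta> \<longrightarrow> aff_dim \<Delta> = int CARD('n) \<longrightarrow> diameter \<Delta> \<ge> 1 \<longrightarrow>
    \<bar>real (card (k_free_points k b \<Delta>))
      - (\<Prod>p | prime p \<and> int p ^ k dvd b. 1 - 1 / real p ^ (k * CARD('n))) * measure lebesgue \<Delta>\<bar>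
    \<le> C * diameter \<Delta> ^ (CARD('n) - 1)"
proof -
  let ?P = "{p. prime p \<and> int p ^ k dvd b}"
  \<comment> \<open>The sieve starts from modulus 1, which is coprime to every prime.\<close>
  obtain C where C: "\<forall>\<Delta> :: (real ^ 'n) set. compact \<Delta> \<longrightarrow> convex \<Delta> \<longrightarrow> diameter \<Delta> \<ge> 1 \<longrightarrow>
    \<bar>real (card (sifted k ?P 1 \<Delta>))
      - (\<Prod>p\<in>?P. 1 - 1 / real p ^ (k * CARD('n))) / real 1 ^ CARD('n) * measure lebesgue \<Delta>\<bar>
    \<le> C * diameter \<Delta> ^ (CARD('n) - 1)"
    using card_sifted_approx[OF finite_prime_power_divisors[OF assms], of 1 k, where 'n = 'n] by auto
  then show ?thesis
    unfolding k_free_points_eq_sifted of_nat_1 power_one div_by_1 by blast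
qed

end
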